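(* Let $G$ be a graph on $n$ vertices and fix a vertex $v\in V(G)$. Let $G^{v}$ be the graph obtained from $G$ by whiskering $v$. Set $a=M(G)$ and $b=M(G-v)$. Then $$M(G^{v})=\min\{a,b\}\quad\text{if } a\neq b,$$ and if $a=b$ then $M(G^{v})\ge a$, with equality unless a cancellation occurs. Moreover, $\alpha(G^{v})=\max\{\alpha(G),\,1+\alpha(G-v)\}$.
   Context: Graphs are finite and simple. Whiskering $v$ means adding one new vertex adjacent only to $v$; $G-v$ is the graph obtained from $G$ by deleting $v$. For a graph $H$, $\alpha(H)$ is its independence number, $P_H(x)=\sum_{i\ge0}g_ix^i$ is its independence polynomial, where $g_i$ is the number of independent sets of $H$ of size $i$, and $M(H)$ is the multiplicity of $x=-1$ as a root of $P_H(x)$ (equal to $0$ if $P_H(-1)\neq 0$). The word "cancellation" refers to cancellation between the lowest-order terms at $x=-1$ of the two summands in $P_{G^{v}}(x)=P_G(x)+xP_{G-v}(x)$. *)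

theory Defs
  imports "Graph_Theory.Graph_Theory" "HOL-Computational_Algebra.Polynomial"
begin

text \<open>
  Finite simple graphs are rendered by the locale \<^locale>\<open>pair_graph\<close>: a finite vertex set with a
  finite, symmetric, irreflexive set of arcs, an undirected edge being a pair of opposite arcs.
  The invariants are defined on \<^typ>\<open>('a, 'b) pre_digraph\<close>, so that they also apply to the
  library's vertex deletion \<^const>\<open>pre_digraph.del_vert\<close>.
\<close>

definition indep_sets :: "('a, 'b) pre_digraph \<Rightarrow> 'a set set" where
  "indep_sets H = {S. S \<subseteq> verts H \<and> (\<forall>x\<in>S. \<forall>y\<in>S. (x, y) \<notin> arcs_ends H)}"

definition indep_num :: "('a, 'b) pre_digraph \<Rightarrow> nat" where
  "indep_num H = Max (card ` indep_sets H)"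

text \<open>No independent set has more than \<^term>\<open>card (verts H)\<close> elements, so the sum may stop there.\<close>

definition indep_poly :: "('a, 'b) pre_digraph \<Rightarrow> int poly" where
  "indep_poly H = (\<Sum>i\<le>card (verts H). monom (int (card {S \<in> indep_sets H. card S = i})) i)"

definition mult_neg1 :: "('a, 'b) pre_digraph \<Rightarrow> nat" where
  "mult_neg1 H = order (-1) (indep_poly H)"

definition whisker :: "'a pair_pre_digraph \<Rightarrow> 'a \<Rightarrow> 'a \<Rightarrow> 'a pair_pre_digraph" where
  "whisker G v w = \<lparr> pverts = insert w (pverts G), parcs = {(v, w), (w, v)} \<union> parcs G \<rparr>"

text \<open>
  The nonzero term of lowest degree in the expansion of \<open>p\<close> in powers of \<open>x - c\<close> (and \<open>0\<close> if
  \<open>p = 0\<close>); the coefficients of that expansion are those of \<open>p(x + c)\<close>.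
\<close>

definition lowest_term_at :: "int \<Rightarrow> int poly \<Rightarrow> int poly" where
  "lowest_term_at c p =
    (let q = pcompose p [:c, 1:]; k = (LEAST k. coeff q k \<noteq> 0)
     in smult (coeff q k) ([:- c, 1:] ^ k))"

text \<open>
  The lowest-order terms at \<open>-1\<close> of the two summands of \<open>P\<^sub>G(x) + x P\<^sub>G\<^sub>-\<^sub>v(x)\<close> cancel.
\<close>

definition cancellation :: "'a pair_pre_digraph \<Rightarrow> 'a \<Rightarrow> bool" where
  "cancellation G v \<longleftrightarrow>
    lowest_term_at (-1) (indep_poly (with_proj G))
    + lowest_term_at (-1) ([:0, 1:] * indep_poly (pre_digraph.del_vert (with_proj G) v)) = 0"

lemma pair_graph_whisker:
  assumes "pair_graph G" "v \<in> pverts G" "w \<notin> pverts G"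
  shows "pair_graph (whisker G v w)"
proof -
  interpret pair_graph G by fact
  have "sym (parcs G)" using pair_sym_arcs by (simp add: symmetric_def)
  then have "sym ({(v, w), (w, v)} \<union> parcs G)" by (auto simp: sym_def)
  then show ?thesis
    using assms(2,3) pair_finite_verts pair_finite_arcs
    by unfold_locales
      (auto simp: whisker_def symmetric_def dest: in_arcsD1 in_arcsD2 pair_no_loops)
qed

end

theory Submission
  imports Defs
begin

text \<open>
  An independent set of \<open>G\<^sup>v\<close> either avoids the new leaf \<open>w\<close>, and then it is an independent set of
  \<open>G\<close>, or contains \<open>w\<close>, and then it avoids \<open>v\<close> and leaves an independent set of \<open>G - v\<close> after
  \<open>w\<close> is removed (lemma \<open>indep_sets_whisker\<close>).  Reading off the largest size gives the formula for
  the independence number, and counting by size gives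
  \<open>P\<^bsub>G\<^sup>v\<^esub>(x) = P\<^sub>G(x) + x P\<^bsub>G-v\<^esub>(x)\<close>.

  The rest concerns polynomials.  Every nonzero \<open>p\<close> is \<open>(x - c)\<^sup>m r(x)\<close> with \<open>r(c) \<noteq> 0\<close>, and then
  \<open>m\<close> is the multiplicity of the root \<open>c\<close> and \<open>r(c) (x - c)\<^sup>m\<close> the lowest-order term at \<open>c\<close>.  Adding
  two polynomials in this form shows that the smaller multiplicity survives if the two differ, and
  that equal ones survive unless the values \<open>r(c)\<close> add up to zero.  Since \<open>x\<close> does not vanish
  at \<open>-1\<close>, the summand \<open>x P\<^bsub>G-v\<^esub>(x)\<close> has the same multiplicity there as \<open>P\<^bsub>G-v\<^esub>(x)\<close>.
  All polynomials involved are nonzero because the empty set gives them the constant term \<open>1\<close>.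
\<close>

section \<open>Multiplicities of a root of a sum\<close>

lemma pcompose_power:
  fixes p q :: "'a::comm_semiring_1 poly"
  shows "pcompose (p ^ n) q = pcompose p q ^ n"
  by (induction n) (simp_all add: pcompose_1 pcompose_mult)

lemma order_power_times:
  fixes r :: "'a::idom poly"
  assumes "poly r c \<noteq> 0"
  shows "order c ([:- c, 1:] ^ m * r) = m"
proof -
  have "r \<noteq> 0" using assms by auto
  then have "order c ([:- c, 1:] ^ m * r) = order c ([:- c, 1:] ^ m) + order c r"
    by (intro order_mult) auto
  then show ?thesis using assms by (simp add: order_power_n_n order_0I)
qed

lemma order_factorization:
  fixes p :: "'a::idom poly"
  assumes "p \<noteq> 0"
  obtains r where "p = [:- c, 1:] ^ order c p * r" "poly r c \<noteq> 0"
  using order_decomp[OF assms, of c] by (metis poly_eq_0_iff_dvd)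

text \<open>
  Substituting \<open>x + c\<close> for \<open>x\<close> turns \<open>(x - c)\<^sup>m r(x)\<close> into \<open>x\<^sup>m r(x + c)\<close>, whose first nonzero
  coefficient is \<open>r(c)\<close>, at \<open>x\<^sup>m\<close>.
\<close>

lemma lowest_term_at_power_times:
  assumes "poly r c \<noteq> 0"
  shows "lowest_term_at c ([:- c, 1:] ^ m * r) = smult (poly r c) ([:- c, 1:] ^ m)"
proof -
  define q where "q = pcompose ([:- c, 1:] ^ m * r) [:c, 1:]"
  have "q = monom 1 m * pcompose r [:c, 1:]"
    by (simp add: q_def pcompose_mult pcompose_power pcompose_pCons monom_altdef)
  then have coeff_q: "coeff q k = (if k < m then 0 else coeff (pcompose r [:c, 1:]) (k - m))" for k
    by (simp add: coeff_monom_mult)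
  have lead: "coeff q m = poly r c"
    by (simp add: coeff_q flip: poly_0_coeff_0) (simp add: poly_pcompose)
  have "(LEAST k. coeff q k \<noteq> 0) = m"
    using assms lead by (intro Least_equality) (auto simp: coeff_q split: if_splits)
  then show ?thesis
    using lead by (simp add: lowest_term_at_def Let_def flip: q_def)
qed

lemma order_add_less:
  fixes p q :: "'a::idom poly"
  assumes "p \<noteq> 0" "q \<noteq> 0" "order c p < order c q"
  shows "order c (p + q) = order c p"
proof -
  obtain r where r: "p = [:- c, 1:] ^ order c p * r" "poly r c \<noteq> 0"
    using order_factorization[OF assms(1)] .
  obtain s where s: "q = [:- c, 1:] ^ order c q * s"
    using order_factorization[OF assms(2)] .
  define d where "d = order c q - order c p"
  have d: "d > 0" "order c q = order c p + d" using assms(3) by (auto simp: d_def)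
  have "p + q = [:- c, 1:] ^ order c p * (r + [:- c, 1:] ^ d * s)"
  proof -
    have "q = [:- c, 1:] ^ order c p * ([:- c, 1:] ^ d * s)"
      by (subst s) (simp only: d(2) power_add mult.assoc)
    then show ?thesis
      by (subst r(1)) (simp only: distrib_left)
  qed
  moreover have "poly (r + [:- c, 1:] ^ d * s) c \<noteq> 0"
    using r(2) d(1) by (simp add: zero_power)
  ultimately show ?thesis by (metis order_power_times)
qed

lemma order_add_neq:
  fixes p q :: "'a::idom poly"
  assumes "p \<noteq> 0" "q \<noteq> 0" "order c p \<noteq> order c q"
  shows "order c (p + q) = min (order c p) (order c q)"
  using order_add_less[of p q c] order_add_less[of q p c] assms
  by (cases "order c p < order c q") (auto simp: add.commute)

text \<open>
  After the common power \<open>(x - c)\<^sup>m\<close> is taken out, the value \<open>r(c) + s(c)\<close> of the remaining sum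
  decides both sides of the equivalence: it is the coefficient of the sum of the lowest-order
  terms, and the multiplicity rises above \<open>m\<close> exactly when it vanishes.
\<close>

lemma order_add_eq:
  assumes "p \<noteq> 0" "q \<noteq> 0" "p + q \<noteq> 0" "order c p = order c q"
  shows "order c (p + q) \<ge> order c p"
    and "order c (p + q) = order c p \<longleftrightarrow> lowest_term_at c p + lowest_term_at c q \<noteq> 0"
proof -
  define m where "m = order c p"
  obtain r where r: "p = [:- c, 1:] ^ m * r" "poly r c \<noteq> 0"
    using order_factorization[OF assms(1)] unfolding m_def .
  obtain s where s: "q = [:- c, 1:] ^ m * s" "poly s c \<noteq> 0"
    using order_factorization[OF assms(2)] unfolding m_def assms(4) .
  have sum: "p + q = [:- c, 1:] ^ m * (r + s)" using r(1) s(1) by (simp add: distrib_left)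
  then have "r + s \<noteq> 0" using assms(3) by auto
  then have ord: "order c (p + q) = m + order c (r + s)"
    using assms(3) by (simp add: sum order_mult order_power_n_n)
  then show "order c (p + q) \<ge> order c p" by (simp add: m_def)
  have "lowest_term_at c p + lowest_term_at c q = smult (poly (r + s) c) ([:- c, 1:] ^ m)"
    using r s by (simp add: lowest_term_at_power_times smult_add_left)
  then show "order c (p + q) = order c p \<longleftrightarrow> lowest_term_at c p + lowest_term_at c q \<noteq> 0"
    using ord \<open>r + s \<noteq> 0\<close> by (simp add: m_def[symmetric] order_root del: poly_add)
qed


section \<open>Independent sets\<close>

lemma finite_indep_sets: "finite (verts H) \<Longrightarrow> finite (indep_sets H)"
  by (rule finite_subset[of _ "Pow (verts H)"]) (auto simp: indep_sets_def)

lemma empty_in_indep_sets: "{} \<in> indep_sets H"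
  by (simp add: indep_sets_def)

text \<open>
  Summing over independent sets instead of over sizes turns a decomposition of the family of
  independent sets directly into an identity of polynomials.
\<close>

lemma indep_poly_eq_sum:
  assumes "finite (verts H)"
  shows "indep_poly H = (\<Sum>S\<in>indep_sets H. monom 1 (card S))"
proof -
  have "card ` indep_sets H \<subseteq> {..card (verts H)}"
    using assms by (auto simp: indep_sets_def card_mono)
  then have "(\<Sum>S\<in>indep_sets H. monom (1::int) (card S))
      = (\<Sum>i\<le>card (verts H). \<Sum>S\<in>{S \<in> indep_sets H. card S = i}. monom 1 (card S))"
    using finite_indep_sets[OF assms] by (intro sum.group[symmetric]) auto
  also have "\<dots> = indep_poly H"
    unfolding indep_poly_def
    by (intro sum.cong) (auto simp: of_nat_poly mult_monom monom_0[symmetric])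
  finally show ?thesis by simp
qed

lemma indep_poly_nonzero:
  assumes "finite (verts H)"
  shows "indep_poly H \<noteq> 0"
proof -
  have "{S \<in> indep_sets H. card S = 0} = {{}}"
    using assms by (auto simp: indep_sets_def dest: finite_subset)
  then have "coeff (indep_poly H) 0 = 1"
    by (simp add: indep_poly_def coeff_sum)
  then show ?thesis by auto
qed


section \<open>Whiskering\<close>

lemma indep_sets_del_vert:
  "indep_sets (pre_digraph.del_vert H v) = {S \<in> indep_sets H. v \<notin> S}"
  by (fastforce simp: indep_sets_def arcs_ends_def arc_to_ends_def pre_digraph.del_vert_def)

lemma indep_sets_whisker:
  assumes "pair_wf_digraph G" "v \<in> pverts G" "w \<notin> pverts G"
  shows "indep_sets (with_proj (whisker G v w))
    = indep_sets (with_proj G) \<union> insert w ` indep_sets (pre_digraph.del_vert (with_proj G) v)"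
    (is "?L = ?A \<union> insert w ` ?B")
proof -
  interpret pair_wf_digraph G by fact
  have no_arc: "(w, x) \<notin> parcs G" "(x, w) \<notin> parcs G" for x
    using assms(3) by (auto dest: in_arcsD1 in_arcsD2)
  have "S \<in> ?A \<union> insert w ` ?B" if S: "S \<in> ?L" for S
  proof (cases "w \<in> S")
    case True
    with S no_arc have "S - {w} \<in> ?B"
      unfolding indep_sets_del_vert by (auto simp: indep_sets_def whisker_def)
    with True show ?thesis by (metis UnI2 image_eqI insert_Diff)
  next
    case False
    with S show ?thesis by (auto simp: indep_sets_def whisker_def)
  qed
  moreover have "S \<in> ?L" if "S \<in> ?A" for S
    using that assms(3) by (auto simp: indep_sets_def whisker_def)
  moreover have "insert w S \<in> ?L" if "S \<in> ?B" for S
    using that assms(2,3) no_arc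
    unfolding indep_sets_del_vert by (auto simp: indep_sets_def whisker_def)
  ultimately show ?thesis by blast
qed

lemma indep_poly_whisker:
  assumes "pair_fin_digraph G" "v \<in> pverts G" "w \<notin> pverts G"
  shows "indep_poly (with_proj (whisker G v w))
    = indep_poly (with_proj G) + [:0, 1:] * indep_poly (pre_digraph.del_vert (with_proj G) v)"
proof -
  interpret pair_fin_digraph G by fact
  let ?A = "indep_sets (with_proj G)" and ?D = "pre_digraph.del_vert (with_proj G) v"
  have fin: "finite (verts (with_proj G))" "finite (verts ?D)"
      "finite (verts (with_proj (whisker G v w)))"
    by (auto simp: pre_digraph.del_vert_def whisker_def)
  have w: "w \<notin> S" "finite S" if "S \<in> indep_sets ?D" for S
    using that assms(3) finite_subset[OF _ pair_finite_verts]
    unfolding indep_sets_del_vert by (auto simp: indep_sets_def)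
  have inj: "inj_on (insert w) (indep_sets ?D)"
    using w(1) by (meson inj_onI insert_ident)
  have disj: "?A \<inter> insert w ` indep_sets ?D = {}"
    using assms(3) by (auto simp: indep_sets_def)
  have "(\<Sum>S\<in>insert w ` indep_sets ?D. monom (1::int) (card S))
      = (\<Sum>S\<in>indep_sets ?D. [:0, 1:] * monom 1 (card S))"
    using w by (subst sum.reindex[OF inj]) (auto intro!: sum.cong simp: monom_Suc)
  then show ?thesis
    using fin disj indep_sets_whisker[OF pair_wf_digraph_axioms assms(2,3)]
    by (simp add: indep_poly_eq_sum sum.union_disjoint finite_indep_sets sum_distrib_left)
qed

lemma indep_num_whisker:
  assumes "pair_fin_digraph G" "v \<in> pverts G" "w \<notin> pverts G"
  shows "indep_num (with_proj (whisker G v w))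
    = max (indep_num (with_proj G)) (1 + indep_num (pre_digraph.del_vert (with_proj G) v))"
proof -
  interpret pair_fin_digraph G by fact
  let ?A = "indep_sets (with_proj G)" and ?B = "indep_sets (pre_digraph.del_vert (with_proj G) v)"
  have fin: "finite ?A" "finite ?B"
    by (auto intro!: finite_indep_sets simp: pre_digraph.del_vert_def)
  have ne: "?A \<noteq> {}" "?B \<noteq> {}" using empty_in_indep_sets by blast+
  have "card (insert w S) = Suc (card S)" if "S \<in> ?B" for S
  proof -
    have "w \<notin> S" "finite S"
      using that assms(3) finite_subset[OF _ pair_finite_verts]
      unfolding indep_sets_del_vert by (auto simp: indep_sets_def)
    then show ?thesis by simp
  qed
  then have "card ` insert w ` ?B = Suc ` card ` ?B"
    unfolding image_image by (intro image_cong) auto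
  then have "Max (card ` (?A \<union> insert w ` ?B)) = max (Max (card ` ?A)) (Max (Suc ` card ` ?B))"
    using fin ne by (simp add: image_Un Max_Un)
  also have "Max (Suc ` card ` ?B) = Suc (Max (card ` ?B))"
    using fin ne by (intro mono_Max_commute[symmetric]) (auto simp: mono_def)
  finally show ?thesis
    by (simp add: indep_num_def indep_sets_whisker[OF pair_wf_digraph_axioms assms(2,3)])
qed

theorem lemma7p2:
  fixes G :: "'a pair_pre_digraph" and v w :: 'a and n a b :: nat
  assumes "pair_graph G"
    and "card (pverts G) = n"
    and "v \<in> pverts G"
    and "w \<notin> pverts G"
    and "a = mult_neg1 (with_proj G)"
    and "b = mult_neg1 (pre_digraph.del_vert (with_proj G) v)"
  shows "(a \<noteq> b \<longrightarrow> mult_neg1 (with_proj (whisker G v w)) = min a b)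
    \<and> (a = b \<longrightarrow> mult_neg1 (with_proj (whisker G v w)) \<ge> a
        \<and> (mult_neg1 (with_proj (whisker G v w)) = a \<longleftrightarrow> \<not> cancellation G v))
    \<and> indep_num (with_proj (whisker G v w))
        = max (indep_num (with_proj G)) (1 + indep_num (pre_digraph.del_vert (with_proj G) v))"
proof -
  interpret pair_graph G by fact
  let ?D = "pre_digraph.del_vert (with_proj G) v"
  define p where "p = indep_poly (with_proj G)"
  define q where "q = [:0, 1:] * indep_poly ?D"
  have D: "indep_poly ?D \<noteq> 0"
    by (intro indep_poly_nonzero) (simp add: pre_digraph.del_vert_def)
  have p: "p \<noteq> 0" unfolding p_def by (intro indep_poly_nonzero) simp
  have q: "q \<noteq> 0" using D by (simp add: q_def)
  have whisker: "indep_poly (with_proj (whisker G v w)) = p + q"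
    using indep_poly_whisker[OF pair_fin_digraph_axioms assms(3,4)] by (simp add: p_def q_def)
  have "p + q \<noteq> 0"
    unfolding whisker[symmetric] by (intro indep_poly_nonzero) (simp add: whisker_def)
  moreover have "a = order (-1) p" by (simp add: assms(5) mult_neg1_def p_def)
  moreover have "b = order (-1) q"
  proof -
    have "order (-1) q = order (-1) [:0, 1 :: int:] + order (-1) (indep_poly ?D)"
      using q unfolding q_def by (rule order_mult)
    also have "order (-1) [:0, 1 :: int:] = 0" by (rule order_0I) simp
    finally show ?thesis by (simp add: assms(6) mult_neg1_def)
  qed
  moreover have "cancellation G v \<longleftrightarrow> lowest_term_at (-1) p + lowest_term_at (-1) q = 0"
    by (simp only: cancellation_def p_def q_def)
  ultimately show ?thesis
    using order_add_neq[OF p q, of "-1"] order_add_eq[OF p q, of "-1"]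
      indep_num_whisker[OF pair_fin_digraph_axioms assms(3,4)]
    by (simp add: mult_neg1_def whisker)
qed

end
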